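(* Let $f,g:\mathbb{R}^d\to\mathbb{R}$ be differentiable, convex and $G$-Lipschitz ($G>0$), and let $w^\ast$ be a solution of $\min_{w\in\mathbb{R}^d} f(w)$ subject to $g(w)\le 0$. Let $T\ge 1$ be an integer, $w_1\in\mathbb{R}^d$, $D:=\|w_1-w^\ast\|$, and let the iterates be generated by the switching proximal point method $$w_{t+1}=\arg\min_{w\in\mathbb{R}^d}\ h_t(w)+\frac{1}{2\eta}\|w-w_t\|^2,\qquad h_t(w)=\begin{cases}f(w), & g(w_t)\le\epsilon,\\ g(w), & g(w_t)>\epsilon.\end{cases}$$ Define $\mathcal{A}=\{t\in\{1,\dots,T\} : g(w_t)\le\epsilon\}$ and $\bar w=\frac{1}{|\mathcal{A}|}\sum_{t\in\mathcal{A}}w_t$. If $$\epsilon=\frac{\sqrt{2}\,DG}{\sqrt{T}},\qquad \eta=\frac{D}{G\sqrt{2T}},$$ then $\mathcal{A}$ is nonempty, $\bar w$ is well-defined, and $\bar w$ is an $\epsilon$-solution, i.e. $f(\bar w)-f(w^\ast)\le\epsilon$ and $g(\bar w)\le\epsilon$.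
   Context: $\|\cdot\|$ is the Euclidean norm. The tolerance satisfies $\epsilon>0$ (so $\eta>0$). A function $f$ is $G$-Lipschitz if $|f(x)-f(y)|\le G\|x-y\|$ for all $x,y$ (for differentiable $f$, equivalently $\|\nabla f(x)\|\le G$ for all $x$). *)

theory Defs
  imports "HOL-Analysis.Analysis"
begin

definition constrained_minimizer ::
  "('a \<Rightarrow> real) \<Rightarrow> ('a \<Rightarrow> real) \<Rightarrow> 'a \<Rightarrow> bool" where
  "constrained_minimizer f g w \<longleftrightarrow> is_arg_min f (\<lambda>v. g v \<le> 0) w"

definition switching_objective ::
  "('a \<Rightarrow> real) \<Rightarrow> ('a \<Rightarrow> real) \<Rightarrow> real \<Rightarrow> 'a \<Rightarrow> 'a \<Rightarrow> real" where
  "switching_objective f g \<epsilon> u = (if g u \<le> \<epsilon> then f else g)"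

(* Indices start at 1; the value w 0 is never used. Updates 1, ..., T constrain w 2, ..., w (T + 1). *)
definition switching_proximal_iterates ::
  "('a::real_normed_vector \<Rightarrow> real) \<Rightarrow> ('a \<Rightarrow> real) \<Rightarrow> real \<Rightarrow> real \<Rightarrow> nat \<Rightarrow> (nat \<Rightarrow> 'a) \<Rightarrow> bool" where
  "switching_proximal_iterates f g \<epsilon> \<eta> T w \<longleftrightarrow>
     (\<forall>t\<in>{1..T}. is_arg_min
        (\<lambda>v. switching_objective f g \<epsilon> (w t) v + 1 / (2 * \<eta>) * (norm (v - w t))\<^sup>2)
        (\<lambda>_. True) (w (t + 1)))"

definition near_feasible_indices :: "('a \<Rightarrow> real) \<Rightarrow> real \<Rightarrow> nat \<Rightarrow> (nat \<Rightarrow> 'a) \<Rightarrow> nat set" where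
  "near_feasible_indices g \<epsilon> T w = {t \<in> {1..T}. g (w t) \<le> \<epsilon>}"

(* For A = {} this is 0 by the convention 1 / 0 = 0, so it is meaningful only if card A > 0. *)
definition average_iterate :: "nat set \<Rightarrow> (nat \<Rightarrow> 'a::real_vector) \<Rightarrow> 'a" where
  "average_iterate A w = (1 / real (card A)) *\<^sub>R (\<Sum>t\<in>A. w t)"

definition eps_solution ::
  "('a \<Rightarrow> real) \<Rightarrow> ('a \<Rightarrow> real) \<Rightarrow> 'a \<Rightarrow> real \<Rightarrow> 'a \<Rightarrow> bool" where
  "eps_solution f g wstar \<epsilon> v \<longleftrightarrow> f v - f wstar \<le> \<epsilon> \<and> g v \<le> \<epsilon>"

end

theory Submission
  imports Defs
begin

text \<open>
  A minimizer of a convex function plus a quadratic satisfies a three-point inequality. Comparing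
  with the constraint optimum and bounding the decrease of the objective in one step by the
  Lipschitz condition, each step costs at most \<open>\<eta> G\<^sup>2 / 2 = \<epsilon> / 4\<close>, up to a telescoping difference of
  squared distances contributing \<open>D\<^sup>2 / (2 \<eta>) = \<epsilon> T / 2\<close> altogether. Hence the total gap is at most
  \<open>3 \<epsilon> T / 4\<close>, whereas every step with \<open>g (w t) > \<epsilon>\<close> contributes more than \<open>\<epsilon>\<close> to it. So some step
  is nearly feasible, the gaps of \<open>f\<close> over these steps average to at most \<open>\<epsilon>\<close>, and Jensen's
  inequality concludes.
\<close>

text \<open>The negative correction term measures the strong convexity of the squared norm; it is
  the source of the extra distance in \<open>proximal_three_point\<close>.\<close>

lemma norm_convex_combination_power2:
  fixes a b :: "'a::real_inner"
  shows "(norm ((1 - s) *\<^sub>R a + s *\<^sub>R b))\<^sup>2 =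
    (1 - s) * (norm a)\<^sup>2 + s * (norm b)\<^sup>2 - s * (1 - s) * (norm (a - b))\<^sup>2"
  by (simp add: power2_norm_eq_inner inner_add_left inner_add_right inner_diff_left
      inner_diff_right inner_commute algebra_simps)

text \<open>Minimality of \<open>u\<close> is tested only against points of the segment from
  \<open>u\<close> to \<open>z\<close>. Convexity of \<open>h\<close> and the exact expansion of the
  quadratic leave a common factor \<open>s\<close>, which cancels; no subgradient is
  involved.\<close>

lemma proximal_three_point:
  fixes h :: "'a::real_inner \<Rightarrow> real"
  assumes conv: "convex_on UNIV h"
    and min: "is_arg_min (\<lambda>v. h v + c * (norm (v - x))\<^sup>2) (\<lambda>_. True) u"
  shows "h u + c * (norm (u - x))\<^sup>2 + c * (norm (z - u))\<^sup>2 \<le> h z + c * (norm (z - x))\<^sup>2"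
proof -
  have "r * (c * (norm (z - u))\<^sup>2) \<le> h z + c * (norm (z - x))\<^sup>2 - (h u + c * (norm (u - x))\<^sup>2)"
    if r: "0 < r" "r < 1" for r
  proof -
    define s where "s = 1 - r"
    define v where "v = (1 - s) *\<^sub>R u + s *\<^sub>R z"
    have s: "0 < s" "s < 1" using r by (auto simp: s_def)
    have "v - x = (1 - s) *\<^sub>R (u - x) + s *\<^sub>R (z - x)"
      by (simp add: v_def algebra_simps)
    then have "c * (norm (v - x))\<^sup>2 = c * ((1 - s) * (norm (u - x))\<^sup>2 + s * (norm (z - x))\<^sup>2
        - s * (1 - s) * (norm (z - u))\<^sup>2)"
      by (simp add: norm_convex_combination_power2 norm_minus_commute)
    moreover have "h v \<le> (1 - s) * h u + s * h z"
      unfolding v_def using s by (intro convex_onD[OF conv]) auto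
    moreover have "h u + c * (norm (u - x))\<^sup>2 \<le> h v + c * (norm (v - x))\<^sup>2"
      using min by (auto simp: is_arg_min_linorder)
    ultimately have "s * (r * (c * (norm (z - u))\<^sup>2))
        \<le> s * (h z + c * (norm (z - x))\<^sup>2 - (h u + c * (norm (u - x))\<^sup>2))"
      by (simp add: s_def algebra_simps)
    then show ?thesis using s by (simp only: mult_le_cancel_left_pos)
  qed
  \<comment> \<open>This is the limit \<open>r\<close> to 1, in which the comparison point tends to
    \<open>u\<close>.\<close>
  from field_le_mult_one_interval[OF this] show ?thesis by simp
qed

text \<open>The gap splits at \<open>h u\<close>: the Lipschitz condition handles
  \<open>h x - h u\<close>, the three-point inequality handles \<open>h u - h z\<close>.\<close>

lemma proximal_step_gap:
  fixes h :: "'a::real_inner \<Rightarrow> real"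
  assumes conv: "convex_on UNIV h" and lip: "G-lipschitz_on UNIV h" and \<eta>: "\<eta> > 0"
    and min: "is_arg_min (\<lambda>v. h v + 1 / (2 * \<eta>) * (norm (v - x))\<^sup>2) (\<lambda>_. True) u"
  shows "h x - h z \<le> \<eta> * G\<^sup>2 / 2 + ((norm (x - z))\<^sup>2 - (norm (u - z))\<^sup>2) / (2 * \<eta>)"
proof -
  have "h x - h u \<le> G * norm (u - x)"
    using lipschitz_onD[OF lip, of x u] by (simp add: dist_norm norm_minus_commute)
  \<comment> \<open>Young's inequality, weighted so that its quadratic term cancels the squared step
    length from the three-point inequality.\<close>
  moreover have "0 \<le> (norm (u - x) - \<eta> * G)\<^sup>2 / (2 * \<eta>)"
    using \<eta> by simp
  then have "G * norm (u - x) \<le> \<eta> * G\<^sup>2 / 2 + (norm (u - x))\<^sup>2 / (2 * \<eta>)"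
    using \<eta> by (simp add: field_simps power2_eq_square)
  moreover have "h u + (norm (u - x))\<^sup>2 / (2 * \<eta>) + (norm (u - z))\<^sup>2 / (2 * \<eta>)
      \<le> h z + (norm (x - z))\<^sup>2 / (2 * \<eta>)"
    using proximal_three_point[OF conv min, of z] by (simp add: norm_minus_commute)
  ultimately show ?thesis by (simp add: diff_divide_distrib)
qed

text \<open>Only the sum is bounded in the hypothesis, since for \<open>f\<close> just the total gap
  is controlled, not each single value.\<close>

lemma convex_average_le:
  fixes h :: "'a::real_vector \<Rightarrow> real"
  assumes "convex_on UNIV h" "finite A" "A \<noteq> {}" "(\<Sum>t\<in>A. h (w t)) \<le> real (card A) * c"
  shows "h (average_iterate A w) \<le> c"
proof -
  have "card A > 0" using assms by (simp add: card_gt_0_iff)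
  have "h (\<Sum>t\<in>A. (1 / real (card A)) *\<^sub>R w t) \<le> (\<Sum>t\<in>A. 1 / real (card A) * h (w t))"
    using assms by (intro convex_on_sum[where C = UNIV]) auto
  also have "\<dots> = (\<Sum>t\<in>A. h (w t)) / real (card A)"
    by (simp add: sum_divide_distrib)
  also have "\<dots> \<le> c"
    using assms(4) \<open>card A > 0\<close> by (simp add: field_simps)
  finally show ?thesis
    by (simp add: average_iterate_def scaleR_sum_right)
qed

text \<open>The objective may change with \<open>t\<close>, but the reference point \<open>z\<close>
  is fixed, so the distances to it telescope across switches.\<close>

lemma switching_total_gap:
  fixes f g :: "'a::real_inner \<Rightarrow> real"
  assumes "convex_on UNIV f" "convex_on UNIV g"
    and "G-lipschitz_on UNIV f" "G-lipschitz_on UNIV g" and "\<eta> > 0"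
    and iter: "switching_proximal_iterates f g \<epsilon> \<eta> T w"
  defines "h \<equiv> \<lambda>t. switching_objective f g \<epsilon> (w t)"
  shows "(\<Sum>t=1..T. h t (w t) - h t z) \<le> real T * (\<eta> * G\<^sup>2 / 2) + (norm (w 1 - z))\<^sup>2 / (2 * \<eta>)"
proof -
  let ?d = "\<lambda>t. (norm (w t - z))\<^sup>2 / (2 * \<eta>)"
  have "h t (w t) - h t z \<le> \<eta> * G\<^sup>2 / 2 + (?d t - ?d (Suc t))" if "t \<in> {1..T}" for t
    using proximal_step_gap[of "h t" G \<eta> "w t" "w (Suc t)" z] assms that
    by (auto simp: h_def switching_proximal_iterates_def switching_objective_def diff_divide_distrib)
  then have "(\<Sum>t=1..T. h t (w t) - h t z) \<le> (\<Sum>t=1..T. \<eta> * G\<^sup>2 / 2 + (?d t - ?d (Suc t)))"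
    by (rule sum_mono)
  also have "\<dots> = real T * (\<eta> * G\<^sup>2 / 2) - (\<Sum>t=1..T. ?d (Suc t) - ?d t)"
    by (simp add: sum.distrib sum_subtractf)
  also have "(\<Sum>t=1..T. ?d (Suc t) - ?d t) = ?d (Suc T) - ?d 1"
    by (subst sum_Suc_diff) auto
  also have "real T * (\<eta> * G\<^sup>2 / 2) - (?d (Suc T) - ?d 1) \<le> real T * (\<eta> * G\<^sup>2 / 2) + ?d 1"
    using \<open>\<eta> > 0\<close> by simp
  finally show ?thesis .
qed

theorem theorem7:
  fixes f g :: "real ^ 'd \<Rightarrow> real"
    and w :: "nat \<Rightarrow> real ^ 'd"
    and wstar :: "real ^ 'd"
    and G D \<epsilon> \<eta> :: real
    and T :: nat
  assumes "f differentiable_on UNIV" and "g differentiable_on UNIV"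
    and "convex_on UNIV f" and "convex_on UNIV g"
    and "G > 0" and "G-lipschitz_on UNIV f" and "G-lipschitz_on UNIV g"
    and "constrained_minimizer f g wstar"
    and "T \<ge> 1"
    and "D = norm (w 1 - wstar)"
    and "\<epsilon> > 0"
    and "\<epsilon> = sqrt 2 * D * G / sqrt (real T)"
    and "\<eta> = D / (G * sqrt (2 * real T))"
    and "switching_proximal_iterates f g \<epsilon> \<eta> T w"
  shows "near_feasible_indices g \<epsilon> T w \<noteq> {}
    \<and> card (near_feasible_indices g \<epsilon> T w) > 0
    \<and> eps_solution f g wstar \<epsilon> (average_iterate (near_feasible_indices g \<epsilon> T w) w)"
proof -
  define A where "A = near_feasible_indices g \<epsilon> T w"
  define h where "h = (\<lambda>t. switching_objective f g \<epsilon> (w t))"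
  have A: "A = {t \<in> {1..T}. g (w t) \<le> \<epsilon>}" and "finite A" "A \<subseteq> {1..T}"
    by (auto simp: A_def near_feasible_indices_def)
  have "g wstar \<le> 0"
    using assms(8) by (simp add: constrained_minimizer_def is_arg_min_def)
  have T: "real T > 0" and rT: "sqrt (real T) * sqrt (real T) = real T"
    using assms(9) by auto
  \<comment> \<open>With \<open>D = 0\<close> the formula for \<epsilon> would give 0.\<close>
  have "D \<noteq> 0" using assms(11,12) by auto
  then have D: "D > 0" using assms(10) by simp
  have \<eta>: "\<eta> > 0" using assms(5,13) D T by simp
  have rG: "\<eta> * G\<^sup>2 / 2 = \<epsilon> / 4"
    using assms(5) T
    by (simp add: assms(12,13) real_sqrt_mult power2_eq_square field_simps)
  have rD: "D\<^sup>2 / (2 * \<eta>) = \<epsilon> * real T / 2"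
    using assms(5) T D rT
    by (simp add: assms(12,13) real_sqrt_mult power2_eq_square field_simps)
  have "(\<Sum>t=1..T. h t (w t) - h t wstar) \<le> real T * (\<eta> * G\<^sup>2 / 2) + D\<^sup>2 / (2 * \<eta>)"
    unfolding h_def assms(10)
    using assms(3,4,6,7,14) \<eta> by (intro switching_total_gap)
  also have "\<dots> < \<epsilon> * real T"
    unfolding rG rD using mult_pos_pos[OF assms(11) T] by simp
  finally have total: "(\<Sum>t=1..T. h t (w t) - h t wstar) < \<epsilon> * real T" .
  have "(\<Sum>t=1..T. h t (w t) - h t wstar) = (\<Sum>t\<in>{1..T} - A. h t (w t) - h t wstar)
      + (\<Sum>t\<in>A. h t (w t) - h t wstar)"
    using \<open>A \<subseteq> {1..T}\<close> by (intro sum.subset_diff) auto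
  also have "(\<Sum>t\<in>A. h t (w t) - h t wstar) = (\<Sum>t\<in>A. f (w t) - f wstar)"
    by (intro sum.cong) (auto simp: A h_def switching_objective_def)
  finally have split: "(\<Sum>t=1..T. h t (w t) - h t wstar) =
      (\<Sum>t\<in>{1..T} - A. h t (w t) - h t wstar) + (\<Sum>t\<in>A. f (w t) - f wstar)" .
  \<comment> \<open>Outside \<open>A\<close> the objective is \<open>g\<close>, which exceeds
    \<epsilon> at \<open>w t\<close> and is at most 0 at \<open>wstar\<close>. The bound is kept
    non-strict to cover an empty complement; strictness comes from \<open>total\<close>.\<close>
  have "real (card ({1..T} - A)) * \<epsilon> \<le> (\<Sum>t\<in>{1..T} - A. h t (w t) - h t wstar)"
    using \<open>g wstar \<le> 0\<close> by (intro sum_bounded_below) (auto simp: A h_def switching_objective_def)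
  moreover have "real (card ({1..T} - A)) * \<epsilon> = real T * \<epsilon> - real (card A) * \<epsilon>"
    using \<open>finite A\<close> \<open>A \<subseteq> {1..T}\<close> card_mono[OF _ \<open>A \<subseteq> {1..T}\<close>]
    by (simp add: card_Diff_subset of_nat_diff left_diff_distrib)
  ultimately have gap: "(\<Sum>t\<in>A. f (w t) - f wstar) < real (card A) * \<epsilon>"
    using total split by (simp add: mult.commute)
  \<comment> \<open>For empty \<open>A\<close> the strict inequality \<open>gap\<close> would read 0
    < 0.\<close>
  then have "A \<noteq> {}" by auto
  have "f (average_iterate A w) \<le> f wstar + \<epsilon>"
    by (rule convex_average_le[OF assms(3) \<open>finite A\<close> \<open>A \<noteq> {}\<close>])
      (use gap in \<open>simp add: sum_subtractf algebra_simps\<close>)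
  moreover have "g (average_iterate A w) \<le> \<epsilon>"
    by (rule convex_average_le[OF assms(4) \<open>finite A\<close> \<open>A \<noteq> {}\<close>], rule sum_bounded_above)
      (simp add: A)
  ultimately show ?thesis
    using \<open>A \<noteq> {}\<close> \<open>finite A\<close> by (simp add: eps_solution_def card_gt_0_iff flip: A_def)
qed

end
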